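(* For each $i\in N$, let $f_i:X\times X\times X_i\to 2^{Y_i}$ be a correspondence with nonempty values. For each $i\in N$, suppose that: a) $A_i,F_i$ have convex values and open lower sections; b) $f_i(\cdot,x_i,\cdot,y_i,\cdot):X_{-i}\times X_{-i}\times X_i\to 2^{Y_i}$ is lower semicontinuous for each $(x_i,y_i)\in X_i\times X_i$; c) $C_i$ is an upper semicontinuous correspondence; d) for each $(x_{-i},y_{-i})\in X_{-i}\times X_{-i}$ there exists $(x_i,y_i)\in A_i(x_{-i})\times F_i(y_{-i})$ such that $f_i(x,y,u_i)\nsubseteq C_i(x_{-i})$ for each $u_i\in\overline{A}_i(x_{-i})$; e) for each $(x_{-i},y_{-i},u_i)\in X_{-i}\times X_{-i}\times X_i$, $f_i(x_{-i},\cdot,y_{-i},\cdot,u_i):X_i\times X_i\to 2^{Y_i}$ is $C_i(x_{-i})$-quasi-convex. Then there exists a pair $(x^*,y^* )\in X\times X$ such that for each $i\in N$, $x_i^*\in A_i(x^*_{-i})$, $y_i^*\in F_i(y^*_{-i})$ and $f_i(x^*,y^*,u_i)\nsubseteq\mathrm{int}\,C_i(x^*_{-i})$ for each $u_i\in A_i(x^*_{-i})$.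
   Context: Setting. $N=\{1,\dots,n\}$ is finite. For each $i\in N$, $X_i$ is a nonempty convex compact subset of a Hausdorff locally convex space $E_i$ and $Y_i$ is a topological vector space. $X=\prod_{i\in N}X_i$, $X_{-i}=\prod_{j\neq i}X_j$; for $x\in X$ write $x=(x_{-i},x_i)$, and similarly $y=(y_{-i},y_i)$; $f_i(x,y,u_i)$ is also written $f_i(x_{-i},x_i,y_{-i},y_i,u_i)$. A correspondence is a set-valued map. For each $i\in N$, $A_i,F_i:X_{-i}\to 2^{X_i}$ and $C_i:X_{-i}\to 2^{Y_i}$ are correspondences with nonempty values, and for each $x_{-i}\in X_{-i}$, $C_i(x_{-i})$ is a proper, closed and convex cone with $\mathrm{int}\,C_i(x_{-i})\neq\emptyset$. Definitions. For a correspondence $T:U\to 2^V$ between topological spaces: $T$ has open lower sections if $\{u\in U:v\in T(u)\}$ is open for each $v\in V$; $T$ is upper (resp. lower) semicontinuous if for each $u\in U$ and each open $O\subset V$ with $T(u)\subset O$ (resp. $T(u)\cap O\neq\emptyset$) there is an open neighborhood $U'$ of $u$ with $T(u')\subset O$ (resp. $T(u')\cap O\neq\emptyset$) for all $u'\in U'$; $\overline{T}(u)=\{v\in V:(u,v)\in\mathrm{cl}_{U\times V}\,\mathrm{Gr}\,T\}$. For $K$ convex, $Y$ a topological vector space and $D\subset Y$, a correspondence $G:K\to 2^Y$ is $D$-quasi-convex if for any $k_1,k_2\in K$ and $\lambda\in[0,1]$ either $G(k_1)\subseteq G(\lambda k_1+(1-\lambda)k_2)+D$ or $G(k_2)\subseteq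 G(\lambda k_1+(1-\lambda)k_2)+D$. *)

theory Defs
  imports "HOL-Analysis.Analysis"
begin

text \<open>
  The spaces of a finite family may differ from index to index, and their topologies need not come
  from a type class.  A real topological vector space is therefore a topology whose carrier is
  a linear subspace of an ambient real vector space type.  This is no loss of generality: the
  members of any family of real vector spaces embed, as subspaces, into their direct sum.
  The ambient type itself carries no topology.
\<close>

definition real_tvs :: "'a::real_vector topology \<Rightarrow> bool" where
  "real_tvs T \<longleftrightarrow>
     subspace (topspace T) \<and>
     continuous_map (prod_topology T T) T (\<lambda>(x, y). x + y) \<and>
     continuous_map (prod_topology euclideanreal T) T (\<lambda>(c, x). c *\<^sub>R x)"

definition locally_convex_tvs :: "'a::real_vector topology \<Rightarrow> bool" where
  "locally_convex_tvs T \<longleftrightarrow>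
     real_tvs T \<and>
     (\<forall>U. openin T U \<and> 0 \<in> U \<longrightarrow> (\<exists>V. openin T V \<and> convex V \<and> 0 \<in> V \<and> V \<subseteq> U))"

definition nonempty_correspondence ::
    "'a topology \<Rightarrow> 'b topology \<Rightarrow> ('a \<Rightarrow> 'b set) \<Rightarrow> bool" where
  "nonempty_correspondence U V T \<longleftrightarrow> (\<forall>u \<in> topspace U. T u \<noteq> {} \<and> T u \<subseteq> topspace V)"

definition open_lower_sections ::
    "'a topology \<Rightarrow> 'b topology \<Rightarrow> ('a \<Rightarrow> 'b set) \<Rightarrow> bool" where
  "open_lower_sections U V T \<longleftrightarrow> (\<forall>v \<in> topspace V. openin U {u \<in> topspace U. v \<in> T u})"

definition upper_semicontinuous ::
    "'a topology \<Rightarrow> 'b topology \<Rightarrow> ('a \<Rightarrow> 'b set) \<Rightarrow> bool" where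
  "upper_semicontinuous U V T \<longleftrightarrow>
     (\<forall>u \<in> topspace U. \<forall>W. openin V W \<and> T u \<subseteq> W \<longrightarrow>
        (\<exists>U'. openin U U' \<and> u \<in> U' \<and> (\<forall>u' \<in> U'. T u' \<subseteq> W)))"

definition lower_semicontinuous ::
    "'a topology \<Rightarrow> 'b topology \<Rightarrow> ('a \<Rightarrow> 'b set) \<Rightarrow> bool" where
  "lower_semicontinuous U V T \<longleftrightarrow>
     (\<forall>u \<in> topspace U. \<forall>W. openin V W \<and> T u \<inter> W \<noteq> {} \<longrightarrow>
        (\<exists>U'. openin U U' \<and> u \<in> U' \<and> (\<forall>u' \<in> U'. T u' \<inter> W \<noteq> {})))"

definition graph_closure ::
    "'a topology \<Rightarrow> 'b topology \<Rightarrow> ('a \<Rightarrow> 'b set) \<Rightarrow> 'a \<Rightarrow> 'b set" where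
  "graph_closure U V T u =
     {v \<in> topspace V. (u, v) \<in> prod_topology U V closure_of (SIGMA w : topspace U. T w)}"

text \<open>Addition of sets is the Minkowski sum.\<close>

definition quasi_convex_corr ::
    "'k::real_vector set \<Rightarrow> 'y::real_vector set \<Rightarrow> ('k \<Rightarrow> 'y set) \<Rightarrow> bool" where
  "quasi_convex_corr K D G \<longleftrightarrow>
     (\<forall>k\<^sub>1 \<in> K. \<forall>k\<^sub>2 \<in> K. \<forall>l \<in> {0..1::real}.
        G k\<^sub>1 \<subseteq> G (l *\<^sub>R k\<^sub>1 + (1 - l) *\<^sub>R k\<^sub>2) + D \<or>
        G k\<^sub>2 \<subseteq> G (l *\<^sub>R k\<^sub>1 + (1 - l) *\<^sub>R k\<^sub>2) + D)"

text \<open>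
  A cone is proper if it is not the whole space.  When its interior is nonempty it is then also
  different from the zero cone.
\<close>

definition proper_closed_convex_cone :: "'y::real_vector topology \<Rightarrow> 'y set \<Rightarrow> bool" where
  "proper_closed_convex_cone Y C \<longleftrightarrow>
     C \<noteq> {} \<and> C \<noteq> topspace Y \<and> closedin Y C \<and> convex C \<and> cone C"

text \<open>
  With players \<open>{1..n}\<close>, points of the product of the sets \<open>X j\<close> are extensional functions on
  \<open>{1..n}\<close>; points of the product without the factor \<open>i\<close> are extensional functions on
  \<open>{1..n} - {i}\<close>.  The point with components \<open>p\<close> (off \<open>i\<close>) and \<open>a\<close> (at \<open>i\<close>) is \<open>p(i := a)\<close>.
\<close>

definition others_top ::
    "nat \<Rightarrow> (nat \<Rightarrow> 'e topology) \<Rightarrow> (nat \<Rightarrow> 'e set) \<Rightarrow> nat \<Rightarrow> (nat \<Rightarrow> 'e) topology" where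
  "others_top n E X i = product_topology (\<lambda>j. subtopology (E j) (X j)) ({1..n} - {i})"

definition others :: "nat \<Rightarrow> nat \<Rightarrow> (nat \<Rightarrow> 'e) \<Rightarrow> nat \<Rightarrow> 'e" where
  "others n i x = restrict x ({1..n} - {i})"

end

theory Submission
  imports Defs
begin

text \<open>
  An equilibrium pair is a fixed point of one correspondence.  Given the profiles \<open>p\<close> and \<open>q\<close> of
  the other players, let player \<open>i\<close> choose a pair \<open>(a, b)\<close> with \<open>a \<in> A i p\<close>, \<open>b \<in> F i q\<close> and
  \<open>f i (p(i := a)) (q(i := b)) u\<close> not contained in \<open>C i p\<close> for any \<open>u\<close> in the closed graph of \<open>A i\<close>
  over \<open>p\<close>.  Such pairs exist by assumption \<open>d\<close>.  They form a convex set by quasi-convexity and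
  because a convex cone absorbs its own sums (\<open>quasi_convex_corr_noninclusion\<close>).  For fixed
  \<open>(a, b)\<close>, the profiles that admit the choice form an open set: the inclusion
  \<open>f i (p(i := a)) (q(i := b)) u \<subseteq> C i p\<close> is a closed condition on \<open>(p, q, u)\<close> since topological
  vector spaces are regular, and projecting along the compact set \<open>X i\<close> preserves closedness
  (\<open>openin_uniform_noninclusion\<close>).

  Convex nonempty values with open lower sections on a finite product of compact convex Hausdorff
  sets force a fixed point (\<open>Browder_fixed_point_product\<close>): a finite partition of unity replaces
  the correspondence by a continuous map into a polytope, and a fixed point of that map is a convex
  combination of admissible choices.  The map factors through a simplex whose dimension is
  known only within the argument; the simplex is therefore placed in the Hilbert cube,
  where Kuhn's combinatorial lemma yields fixed points (\<open>Hilbert_cube_fixed_point\<close>).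

  At the fixed point the noninclusion holds over the closed graph and for the closed cone, hence a
  fortiori over \<open>A i\<close> and for the interior of the cone.
\<close>

section \<open>A fixed point theorem for the Hilbert cube\<close>

text \<open>
  This is Kuhn's labelling lemma on the grid with \<open>p = k + 1\<close> subdivisions of the first \<open>p\<close>
  coordinates.  A grid point has label 0 in coordinate \<open>i\<close> only if \<open>h\<close> does not decrease that
  coordinate, and label 1 only if \<open>h\<close> does not increase it; in one small cell each of the first
  \<open>p\<close> labels takes both values.  Tying the dimension to the mesh lets one limit \<open>k \<longlongrightarrow> \<infinity>\<close> treat all coordinates at once.
\<close>

lemma approximate_fixed_point_cube:
  fixes h :: "(nat \<Rightarrow> real) \<Rightarrow> nat \<Rightarrow> real"
  assumes h: "\<And>x. x \<in> UNIV \<rightarrow> {0..1} \<Longrightarrow> h x \<in> UNIV \<rightarrow> {0..1}"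
  obtains z where "z \<in> UNIV \<rightarrow> {0..1}"
    and "\<And>i. i \<le> k \<Longrightarrow> \<exists>u \<in> UNIV \<rightarrow> {0..1}. \<exists>v \<in> UNIV \<rightarrow> {0..1}.
      (\<forall>j. \<bar>u j - z j\<bar> \<le> 1 / Suc k) \<and> (\<forall>j. \<bar>v j - z j\<bar> \<le> 1 / Suc k) \<and>
      u i \<le> h u i \<and> h v i \<le> v i"
proof -
  define Q :: "(nat \<Rightarrow> real) set" where "Q = UNIV \<rightarrow> {0..1}"
  define p where "p = Suc k"
  define g :: "(nat \<Rightarrow> nat) \<Rightarrow> nat \<Rightarrow> real" where "g q i = (if i < p then q i / p else 0)" for q i
  have p: "p > 0"
    by (simp add: p_def)
  have gQ: "g q \<in> Q" if "\<forall>i<p. q i \<le> p" for q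
    using that p by (auto simp: Q_def g_def divide_simps)
  have "\<forall>x::nat \<Rightarrow> real. x \<in> Q \<longrightarrow> h x \<in> Q"
    using h by (simp add: Q_def)
  moreover have "\<forall>x::nat \<Rightarrow> real. x \<in> Q \<longrightarrow> (\<forall>i. True \<longrightarrow> 0 \<le> x i \<and> x i \<le> 1)"
    by (auto simp: Q_def Pi_iff)
  ultimately have "\<exists>l. (\<forall>x i. l x i \<le> (1::nat)) \<and>
      (\<forall>x i. x \<in> Q \<and> True \<and> x i = 0 \<longrightarrow> l x i = 0) \<and>
      (\<forall>x i. x \<in> Q \<and> True \<and> x i = 1 \<longrightarrow> l x i = 1) \<and>
      (\<forall>x i. x \<in> Q \<and> True \<and> l x i = 0 \<longrightarrow> x i \<le> h x i) \<and>
      (\<forall>x i. x \<in> Q \<and> True \<and> l x i = 1 \<longrightarrow> h x i \<le> x i)"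
    by (rule kuhn_labelling_lemma')
  then obtain l where l_le: "l x i \<le> (1::nat)"
    and l: "x \<in> Q \<Longrightarrow> x i = 0 \<Longrightarrow> l x i = 0"
      "x \<in> Q \<Longrightarrow> x i = 1 \<Longrightarrow> l x i = 1"
      "x \<in> Q \<Longrightarrow> l x i = 0 \<Longrightarrow> x i \<le> h x i"
      "x \<in> Q \<Longrightarrow> l x i = 1 \<Longrightarrow> h x i \<le> x i" for x i
    by blast
  have l01: "l x i = 0 \<or> l x i = 1" for x i
    using l_le[of x i] by linarith
  obtain q where q: "\<forall>i<p. q i < p"
    and rs: "\<forall>i<p. \<exists>r s. (\<forall>j<p. q j \<le> r j \<and> r j \<le> q j + 1) \<and>
      (\<forall>j<p. q j \<le> s j \<and> s j \<le> q j + 1) \<and> l (g r) i \<noteq> l (g s) i"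
  proof (rule kuhn_lemma[of p p "\<lambda>q. l (g q)"])
    show "\<forall>x. (\<forall>i<p. x i \<le> p) \<longrightarrow> (\<forall>i<p. l (g x) i = 0 \<or> l (g x) i = 1)"
      using l01 by blast
    show "\<forall>x. (\<forall>i<p. x i \<le> p) \<longrightarrow> (\<forall>i<p. x i = 0 \<longrightarrow> l (g x) i = 0)"
      using l(1) gQ by (simp add: g_def)
    show "\<forall>x. (\<forall>i<p. x i \<le> p) \<longrightarrow> (\<forall>i<p. x i = p \<longrightarrow> l (g x) i = 1)"
      using l(2) gQ p by (simp add: g_def)
  qed (use p in auto)
  have near: "g r \<in> Q \<and> (\<forall>j. \<bar>g r j - g q j\<bar> \<le> 1 / Suc k)"
    if r: "\<forall>j<p. q j \<le> r j \<and> r j \<le> q j + 1" for r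
  proof
    show "g r \<in> Q"
      using r q by (intro gQ) (metis Suc_eq_plus1 Suc_leI le_trans)
    have "\<bar>g r j - g q j\<bar> \<le> 1 / p" for j
    proof (cases "j < p")
      case True
      with r have "\<bar>real (r j) - real (q j)\<bar> \<le> 1"
        by (smt (verit) of_nat_1 of_nat_add of_nat_mono)
      then show ?thesis
        using True p by (simp add: g_def diff_divide_distrib[symmetric] divide_right_mono)
    qed (simp add: g_def)
    then show "\<forall>j. \<bar>g r j - g q j\<bar> \<le> 1 / Suc k"
      by (simp add: p_def)
  qed
  show thesis
  proof
    show "g q \<in> UNIV \<rightarrow> {0..1}"
      using gQ q by (simp add: Q_def less_imp_le)
  next
    fix i assume "i \<le> k"
    then obtain r s where r: "\<forall>j<p. q j \<le> r j \<and> r j \<le> q j + 1"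
      and s: "\<forall>j<p. q j \<le> s j \<and> s j \<le> q j + 1" and "l (g r) i \<noteq> l (g s) i"
      using rs by (auto simp: p_def less_Suc_eq_le)
    then consider "l (g r) i = 0" "l (g s) i = 1" | "l (g s) i = 0" "l (g r) i = 1"
      using l01 by metis
    then show "\<exists>u \<in> UNIV \<rightarrow> {0..1}. \<exists>v \<in> UNIV \<rightarrow> {0..1}.
      (\<forall>j. \<bar>u j - g q j\<bar> \<le> 1 / Suc k) \<and> (\<forall>j. \<bar>v j - g q j\<bar> \<le> 1 / Suc k) \<and>
      u i \<le> h u i \<and> h v i \<le> v i"
      using near[OF r] near[OF s] l(3,4) unfolding Q_def by metis
  qed
qed

text \<open>
  By compactness the cells of the preceding lemma accumulate at a point \<open>x\<close>, and for each fixed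
  \<open>i\<close> both witnesses \<open>u\<close> and \<open>v\<close> tend to \<open>x\<close> along the subsequence.  Continuity turns their
  inequalities into \<open>x i \<le> h x i\<close> and \<open>h x i \<le> x i\<close>.  Since simplices of every dimension are
  retracts of this one cube, the theorem contains Brouwer's theorem for all dimensions at once,
  without a type for each dimension.
\<close>

theorem Hilbert_cube_fixed_point:
  fixes h :: "(nat \<Rightarrow> real) \<Rightarrow> nat \<Rightarrow> real"
  assumes cont: "continuous_on (UNIV \<rightarrow> {0..1}) h"
    and h: "\<And>x. x \<in> UNIV \<rightarrow> {0..1} \<Longrightarrow> h x \<in> UNIV \<rightarrow> {0..1}"
  obtains x where "x \<in> UNIV \<rightarrow> {0..1}" and "h x = x"
proof -
  define Q :: "(nat \<Rightarrow> real) set" where "Q = UNIV \<rightarrow> {0..1}"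
  have lim_iff: "((s :: nat \<Rightarrow> nat \<Rightarrow> real) \<longlonglongrightarrow> x) \<longleftrightarrow> (\<forall>i. (\<lambda>k. s k i) \<longlonglongrightarrow> x i)" for s x
    using limitin_componentwise[of "\<lambda>_::nat. euclidean :: real topology" UNIV s x sequentially]
    by (simp add: euclidean_product_topology)
  have "compact Q"
    using compactin_PiE[of "\<lambda>_. euclidean :: real topology" UNIV "\<lambda>_::nat. {0..1}"]
    by (simp add: Q_def PiE_UNIV_domain euclidean_product_topology)
  have "\<exists>z u v. z \<in> Q \<and> (\<forall>i\<le>k. u i \<in> Q \<and> v i \<in> Q \<and>
      (\<forall>j. \<bar>u i j - z j\<bar> \<le> 1 / Suc k) \<and> (\<forall>j. \<bar>v i j - z j\<bar> \<le> 1 / Suc k) \<and>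
      u i i \<le> h (u i) i \<and> h (v i) i \<le> v i i)" for k
    using approximate_fixed_point_cube[of h k] h unfolding Q_def by metis
  then obtain z u v where zQ: "z k \<in> Q"
    and uv: "i \<le> k \<Longrightarrow> u k i \<in> Q \<and> v k i \<in> Q \<and>
      (\<forall>j. \<bar>u k i j - z k j\<bar> \<le> 1 / Suc k) \<and> (\<forall>j. \<bar>v k i j - z k j\<bar> \<le> 1 / Suc k) \<and>
      u k i i \<le> h (u k i) i \<and> h (v k i) i \<le> v k i i" for i k
    by metis
  obtain x \<phi> where x: "x \<in> Q" and \<phi>: "strict_mono \<phi>" and zx: "(z \<circ> \<phi>) \<longlonglongrightarrow> x"
    using \<open>compact Q\<close> zQ unfolding compact_eq_seq_compact_metric seq_compact_def by meson
  have ev: "\<forall>\<^sub>F k in sequentially. i \<le> \<phi> k" for i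
    using filterlim_subseq[OF \<phi>] by (simp add: filterlim_at_top)
  \<comment> \<open>The witnesses for coordinate \<open>i\<close> exist only from stage \<open>i\<close> on, which suffices for limits.\<close>
  have lim: "(\<lambda>k. h (w (\<phi> k)) i) \<longlonglongrightarrow> h x i" "(\<lambda>k. w (\<phi> k) i) \<longlonglongrightarrow> x i"
    if wQ: "\<And>k. i \<le> k \<Longrightarrow> w k \<in> Q"
      and wz: "\<And>j k. i \<le> k \<Longrightarrow> \<bar>w k j - z k j\<bar> \<le> 1 / Suc k" for w i
  proof -
    have "(\<lambda>k. w (\<phi> k) j) \<longlonglongrightarrow> x j" for j
    proof -
      have "(\<lambda>k. 1 / real (Suc (\<phi> k))) \<longlonglongrightarrow> 0"
        using LIMSEQ_subseq_LIMSEQ[OF LIMSEQ_Suc[OF lim_1_over_n] \<phi>] by (simp add: o_def)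
      then have "(\<lambda>k. w (\<phi> k) j - z (\<phi> k) j) \<longlonglongrightarrow> 0"
        by (rule Lim_null_comparison[rotated])
          (use ev in eventually_elim, use wz in \<open>simp del: of_nat_Suc\<close>)
      moreover have "(\<lambda>k. z (\<phi> k) j) \<longlonglongrightarrow> x j"
        using zx by (simp add: lim_iff o_def)
      ultimately show ?thesis
        using tendsto_add by fastforce
    qed
    then have w: "(\<lambda>k. w (\<phi> k)) \<longlonglongrightarrow> x" and "(\<lambda>k. w (\<phi> k) i) \<longlonglongrightarrow> x i"
      by (simp_all add: lim_iff)
    show "(\<lambda>k. w (\<phi> k) i) \<longlonglongrightarrow> x i" by fact
    have "(\<lambda>k. h (w (\<phi> k))) \<longlonglongrightarrow> h x"
    proof (rule continuous_on_tendsto_compose[OF _ w])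
      show "continuous_on Q h"
        using cont by (simp add: Q_def)
      show "\<forall>\<^sub>F k in sequentially. w (\<phi> k) \<in> Q"
        using ev by eventually_elim (rule wQ)
    qed (fact x)
    then show "(\<lambda>k. h (w (\<phi> k)) i) \<longlonglongrightarrow> h x i"
      by (simp add: lim_iff)
  qed
  have "h x i = x i" for i
  proof (rule antisym)
    show "x i \<le> h x i"
      by (rule tendsto_le[OF _ lim(1)[of i "\<lambda>k. u k i"] lim(2)[of i "\<lambda>k. u k i"]])
        (use uv in \<open>auto intro: eventually_mono[OF ev]\<close>)
    show "h x i \<le> x i"
      by (rule tendsto_le[OF _ lim(2)[of i "\<lambda>k. v k i"] lim(1)[of i "\<lambda>k. v k i"]])
        (use uv in \<open>auto intro: eventually_mono[OF ev]\<close>)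
  qed
  then have "h x = x"
    by (rule ext)
  then show thesis
    using that x by (simp add: Q_def)
qed

section \<open>Real topological vector spaces\<close>

lemma real_tvsD:
  assumes "real_tvs T"
  shows "subspace (topspace T)"
    and "continuous_map (prod_topology T T) T (\<lambda>(x, y). x + y)"
    and "continuous_map (prod_topology euclideanreal T) T (\<lambda>(c, x). c *\<^sub>R x)"
  using assms by (simp_all add: real_tvs_def)

lemma real_tvs_continuous_map_add:
  assumes "real_tvs T" "continuous_map Z T g" "continuous_map Z T h"
  shows "continuous_map Z T (\<lambda>z. g z + h z)"
  using continuous_map_compose[OF continuous_map_pairedI[OF assms(2,3)] real_tvsD(2)[OF assms(1)]]
  by (simp add: o_def)

lemma real_tvs_continuous_map_scaleR:
  assumes "real_tvs T" "continuous_map Z euclideanreal g" "continuous_map Z T h"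
  shows "continuous_map Z T (\<lambda>z. g z *\<^sub>R h z)"
  using continuous_map_compose[OF continuous_map_pairedI[OF assms(2,3)] real_tvsD(3)[OF assms(1)]]
  by (simp add: o_def)

lemma real_tvs_continuous_map_sum:
  assumes T: "real_tvs T" and "\<And>k. k \<in> I \<Longrightarrow> continuous_map Z T (g k)"
  shows "continuous_map Z T (\<lambda>z. \<Sum>k\<in>I. g k z)"
  using assms(2)
proof (induction I rule: infinite_finite_induct)
  case (insert k I)
  then show ?case
    by (simp add: real_tvs_continuous_map_add[OF T])
qed (simp_all add: subspace_0[OF real_tvsD(1)[OF T]])

lemma real_tvs_prod_topology:
  assumes S: "real_tvs S" and T: "real_tvs T"
  shows "real_tvs (prod_topology S T)"
  unfolding real_tvs_def
proof (intro conjI)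
  show "subspace (topspace (prod_topology S T))"
    using subspace_Times[OF real_tvsD(1)[OF S] real_tvsD(1)[OF T]] by simp
  let ?P = "prod_topology S T"
  note components = continuous_map_fst_of[unfolded o_def] continuous_map_snd_of[unfolded o_def]
  have "continuous_map (prod_topology ?P ?P) ?P
      (\<lambda>z. (fst (fst z) + fst (snd z), snd (fst z) + snd (snd z)))"
    by (intro continuous_map_pairedI real_tvs_continuous_map_add[OF S]
        real_tvs_continuous_map_add[OF T] components[OF continuous_map_fst]
        components[OF continuous_map_snd])
  then show "continuous_map (prod_topology ?P ?P) ?P (\<lambda>(x, y). x + y)"
    by (simp add: case_prod_unfold plus_prod_def)
  have "continuous_map (prod_topology euclideanreal ?P) ?P
      (\<lambda>z. (fst z *\<^sub>R fst (snd z), fst z *\<^sub>R snd (snd z)))"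
    by (intro continuous_map_pairedI real_tvs_continuous_map_scaleR[OF S]
        real_tvs_continuous_map_scaleR[OF T] continuous_map_fst components[OF continuous_map_snd])
  then show "continuous_map (prod_topology euclideanreal ?P) ?P (\<lambda>(c, x). c *\<^sub>R x)"
    by (simp add: case_prod_unfold scaleR_prod_def)
qed

text \<open>
  If \<open>z\<close> is outside the closed set \<open>C\<close>, continuity of \<open>(u, v) \<mapsto> z + u - v\<close> at the origin gives
  neighbourhoods \<open>U\<close> and \<open>V\<close> of 0 with \<open>z + U - V\<close> disjoint from \<open>C\<close>; then \<open>z + U\<close> and \<open>C + V\<close>
  are disjoint.
\<close>

lemma real_tvs_regular_space:
  assumes T: "real_tvs T"
  shows "regular_space T"
  unfolding regular_space_def
proof (intro allI impI, elim conjE)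
  fix C z
  assume C: "closedin T C" and z: "z \<in> topspace T - C"
  note sub = real_tvsD(1)[OF T]
  have "continuous_map (prod_topology T T) T (\<lambda>p. (z + fst p) + (- 1) *\<^sub>R snd p)"
    by (intro real_tvs_continuous_map_add[OF T] real_tvs_continuous_map_scaleR[OF T] continuous_intros)
      (use z in auto)
  then have "openin (prod_topology T T)
      {p \<in> topspace (prod_topology T T). (z + fst p) + (- 1) *\<^sub>R snd p \<in> topspace T - C}"
    (is "openin _ ?D")
    using C by (intro openin_continuous_map_preimage) (auto simp: closedin_def)
  moreover have "(0, 0) \<in> ?D"
    using z subspace_0[OF sub] by simp
  ultimately obtain U V where U: "openin T U" "0 \<in> U" and V: "openin T V" "0 \<in> V"
    and UV: "U \<times> V \<subseteq> ?D"
    unfolding openin_prod_topology_alt[of T T ?D] by blast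
  \<comment> \<open>\<open>tr a S\<close> is the translate \<open>a + S\<close>, written as a preimage so that it is visibly open.\<close>
  define tr where "tr a S = {y \<in> topspace T. y + (- 1) *\<^sub>R a \<in> S}" for a S
  have tr: "openin T (tr a S)" if "a \<in> topspace T" "openin T S" for a S
    unfolding tr_def
    by (rule openin_continuous_map_preimage[OF _ that(2)], intro real_tvs_continuous_map_add[OF T])
      (use that subspace_mul[OF sub, of a "-1"] in auto)
  have C_sub: "C \<subseteq> topspace T"
    using C closedin_subset by blast
  show "\<exists>G W. openin T G \<and> openin T W \<and> z \<in> G \<and> C \<subseteq> W \<and> disjnt G W"
  proof (intro exI conjI)
    show "openin T (tr z U)" "openin T (\<Union>c\<in>C. tr c V)"
      using tr z U V C_sub by blast+
    show "z \<in> tr z U" "C \<subseteq> (\<Union>c\<in>C. tr c V)"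
      using z U V C_sub by (auto simp: tr_def)
    show "disjnt (tr z U) (\<Union>c\<in>C. tr c V)"
    proof -
      have False if "y \<in> tr z U" "c \<in> C" "y \<in> tr c V" for y c
      proof -
        have "(y + (- 1) *\<^sub>R z, y + (- 1) *\<^sub>R c) \<in> U \<times> V"
          using that by (simp add: tr_def)
        then have "(z + (y + (- 1) *\<^sub>R z)) + (- 1) *\<^sub>R (y + (- 1) *\<^sub>R c) \<notin> C"
          using UV by fastforce
        then show False
          using \<open>c \<in> C\<close> by simp
      qed
      then show ?thesis
        by (auto simp: disjnt_iff)
    qed
  qed
qed

section \<open>Browder's fixed point theorem for products\<close>

text \<open>
  Around each point \<open>x\<close>, complete regularity provides a bump function that is positive at \<open>x\<close> and
  vanishes off one of the sets \<open>D s\<close>.  Finitely many positivity sets cover the space, and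
  dividing by the sum of the chosen bumps normalises them.  The functions are indexed by bumps, so
  the same \<open>s\<close> may occur several times.
\<close>

lemma finite_partition_of_unity:
  assumes P: "compact_space P" "Hausdorff_space P"
    and D: "\<And>s. s \<in> S \<Longrightarrow> openin P (D s)"
    and cover: "topspace P \<subseteq> (\<Union>s\<in>S. D s)"
  obtains m :: nat and s :: "nat \<Rightarrow> 's" and \<psi> :: "nat \<Rightarrow> 'a \<Rightarrow> real"
  where "\<And>k. k < m \<Longrightarrow> s k \<in> S"
    and "\<And>k. k < m \<Longrightarrow> continuous_map P euclideanreal (\<psi> k)"
    and "\<And>k y. k < m \<Longrightarrow> y \<in> topspace P \<Longrightarrow> 0 \<le> \<psi> k y"
    and "\<And>y. y \<in> topspace P \<Longrightarrow> (\<Sum>k<m. \<psi> k y) = 1"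
    and "\<And>k y. k < m \<Longrightarrow> y \<in> topspace P \<Longrightarrow> 0 < \<psi> k y \<Longrightarrow> y \<in> D (s k)"
proof -
  have reg: "completely_regular_space P"
    using P by (simp add: compact_Hausdorff_or_regular_imp_normal_space normal_imp_completely_regular_space)
  have "\<exists>s \<phi>. s \<in> S \<and> continuous_map P euclideanreal \<phi> \<and> (\<forall>y \<in> topspace P. 0 \<le> \<phi> y) \<and>
      0 < \<phi> x \<and> (\<forall>y \<in> topspace P. 0 < \<phi> y \<longrightarrow> y \<in> D s)"
    if x: "x \<in> topspace P" for x
  proof -
    obtain s where s: "s \<in> S" "x \<in> D s"
      using cover x by blast
    then have "closedin P (topspace P - D s)" and "x \<in> topspace P - (topspace P - D s)"
      using D x by auto
    then obtain g :: "'a \<Rightarrow> real" where g: "continuous_map P (top_of_set {0..1}) g"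
      and "g x = 0" and g1: "g ` (topspace P - D s) \<subseteq> {1}"
      using reg unfolding completely_regular_space_def by blast
    from g have "continuous_map P euclideanreal (\<lambda>y. 1 - g y)"
      by (intro continuous_map_diff) (auto simp: continuous_map_in_subtopology)
    moreover have "\<forall>y \<in> topspace P. g y \<le> 1"
      using g by (auto simp: continuous_map_in_subtopology Pi_iff)
    moreover have "\<forall>y \<in> topspace P. 0 < 1 - g y \<longrightarrow> y \<in> D s"
      using g1 by fastforce
    ultimately show ?thesis
      using s(1) \<open>g x = 0\<close> by (intro exI[of _ s] exI[of _ "\<lambda>y. 1 - g y"]) auto
  qed
  then have "\<forall>x \<in> topspace P. \<exists>s \<phi>. s \<in> S \<and> continuous_map P euclideanreal \<phi> \<and>
      (\<forall>y \<in> topspace P. 0 \<le> \<phi> y) \<and> 0 < \<phi> x \<and> (\<forall>y \<in> topspace P. 0 < \<phi> y \<longrightarrow> y \<in> D s)"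
    by (rule ballI)
  then have "\<exists>s \<phi>. \<forall>x \<in> topspace P. s x \<in> S \<and> continuous_map P euclideanreal (\<phi> x) \<and>
      (\<forall>y \<in> topspace P. 0 \<le> \<phi> x y) \<and> 0 < \<phi> x x \<and>
      (\<forall>y \<in> topspace P. 0 < \<phi> x y \<longrightarrow> y \<in> D (s x))"
    unfolding bchoice_iff .
  then obtain s \<phi> where s: "x \<in> topspace P \<Longrightarrow> s x \<in> S"
    and \<phi>: "x \<in> topspace P \<Longrightarrow> continuous_map P euclideanreal (\<phi> x)"
      "x \<in> topspace P \<Longrightarrow> y \<in> topspace P \<Longrightarrow> 0 \<le> \<phi> x y"
      "x \<in> topspace P \<Longrightarrow> 0 < \<phi> x x"
      "x \<in> topspace P \<Longrightarrow> y \<in> topspace P \<Longrightarrow> 0 < \<phi> x y \<Longrightarrow> y \<in> D (s x)" for x y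
    by blast
  define U where "U x = {y \<in> topspace P. \<phi> x y \<in> {0<..}}" for x
  have "openin P (U x)" if "x \<in> topspace P" for x
    unfolding U_def by (rule openin_continuous_map_preimage[OF \<phi>(1)[OF that]]) simp
  moreover have "topspace P \<subseteq> (\<Union>x\<in>topspace P. U x)"
    using \<phi>(3) by (auto simp: U_def)
  ultimately have "\<exists>\<F>. finite \<F> \<and> \<F> \<subseteq> U ` topspace P \<and> topspace P \<subseteq> \<Union>\<F>"
    using P(1) unfolding compact_space_alt by (elim allE[of _ "U ` topspace P"]) auto
  then obtain F where F: "finite F" "F \<subseteq> topspace P" "topspace P \<subseteq> (\<Union>x\<in>F. U x)"
    by (elim exE conjE) (drule (1) finite_subset_image, blast)
  obtain e where e: "bij_betw e {..<card F} F"
    using ex_bij_betw_nat_finite[OF F(1)] by (auto simp: atLeast0LessThan)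
  have eF: "e k \<in> topspace P" if "k < card F" for k
    using e F(2) that by (auto simp: bij_betw_def)
  define \<sigma> where "\<sigma> y = (\<Sum>k<card F. \<phi> (e k) y)" for y
  have pos: "0 < \<sigma> y" if y: "y \<in> topspace P" for y
  proof -
    obtain x where "x \<in> F" "0 < \<phi> x y"
      using F(3) y by (auto simp: U_def)
    moreover from this e obtain k where "k < card F" "x = e k"
      by (auto simp: bij_betw_def)
    ultimately have k: "k < card F" "0 < \<phi> (e k) y"
      by simp_all
    then show ?thesis
      unfolding \<sigma>_def using k \<phi>(2) eF y by (intro sum_pos2[of _ k]) auto
  qed
  have cont: "continuous_map P euclideanreal \<sigma>"
    unfolding \<sigma>_def by (intro continuous_map_sum \<phi>(1) eF) auto
  show thesis
  proof (rule that[of "card F" "s \<circ> e" "\<lambda>k y. \<phi> (e k) y / \<sigma> y"])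
    show "continuous_map P euclideanreal (\<lambda>y. \<phi> (e k) y / \<sigma> y)" if "k < card F" for k
      using pos by (intro continuous_map_real_divide \<phi>(1) eF that cont) force
    show "(\<Sum>k<card F. \<phi> (e k) y / \<sigma> y) = 1" if "y \<in> topspace P" for y
      using pos[OF that] by (simp add: sum_divide_distrib[symmetric] \<sigma>_def[symmetric])
    show "y \<in> D ((s \<circ> e) k)" if "k < card F" "y \<in> topspace P" "0 < \<phi> (e k) y / \<sigma> y" for k y
      using that pos[OF that(2)] \<phi>(4) eF by (simp add: zero_less_divide_iff)
  qed (use s \<phi>(2) eF pos in \<open>auto intro!: divide_nonneg_pos\<close>)
qed

text \<open>
  The map \<open>x \<mapsto> (\<Sum>k<m. \<psi> k x *\<^sub>R s k)\<close> factors through the simplex of weights: \<open>\<psi>\<close> sends points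
  to weights and \<open>b\<close> sends weights to points.  Composing in the other order gives the self-map
  \<open>\<psi> \<circ> b\<close> of a finite-dimensional simplex, and \<open>b\<close> carries its fixed points to fixed points of
  the original map.
\<close>

lemma fixed_point_of_finite_barycentric_map:
  fixes E :: "'i \<Rightarrow> 'e::real_vector topology" and m :: nat
  assumes E: "\<And>j. j \<in> J \<Longrightarrow> real_tvs (E j)"
    and K: "\<And>j. j \<in> J \<Longrightarrow> K j \<subseteq> topspace (E j) \<and> convex (K j)"
    and s: "\<And>k. k < m \<Longrightarrow> s k \<in> (\<Pi>\<^sub>E j\<in>J. K j)"
    and m: "0 < m"
    and cont: "\<And>k. k < m \<Longrightarrow>
      continuous_map (product_topology (\<lambda>j. subtopology (E j) (K j)) J) euclideanreal (\<psi> k)"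
    and nonneg: "\<And>k x. k < m \<Longrightarrow> x \<in> (\<Pi>\<^sub>E j\<in>J. K j) \<Longrightarrow> 0 \<le> \<psi> k x"
    and sum_1: "\<And>x. x \<in> (\<Pi>\<^sub>E j\<in>J. K j) \<Longrightarrow> (\<Sum>k<m. \<psi> k x) = 1"
  shows "\<exists>x \<in> (\<Pi>\<^sub>E j\<in>J. K j). \<forall>j \<in> J. x j = (\<Sum>k<m. \<psi> k x *\<^sub>R s k j)"
proof -
  define P where "P = product_topology (\<lambda>j. subtopology (E j) (K j)) J"
  have top: "topspace P = (\<Pi>\<^sub>E j\<in>J. K j)"
    unfolding P_def topspace_product_topology by (rule PiE_cong) (use K in auto)
  define Q :: "(nat \<Rightarrow> real) set" where "Q = UNIV \<rightarrow> {0..1}"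
  define \<sigma> :: "(nat \<Rightarrow> real) \<Rightarrow> real" where "\<sigma> l = (\<Sum>k<m. l k)" for l
  \<comment> \<open>The retraction \<open>w\<close> of the cube onto the simplex extends \<open>\<psi> \<circ> b\<close> to the whole cube: the
      numerators sum to \<open>max 1 (\<sigma> l)\<close>, and \<open>w k l = l k\<close> when \<open>\<sigma> l = 1\<close>.\<close>
  define w where "w k l = (l k + max 0 (1 - \<sigma> l) / m) / max 1 (\<sigma> l)" for k l
  define b where "b l = (\<lambda>j\<in>J. \<Sum>k<m. w k l *\<^sub>R s k j)" for l
  define h where "h l k = (if k < m then \<psi> k (b l) else 0)" for l k
  have w_nonneg: "0 \<le> w k l" if "l \<in> Q" for k l
    using that by (auto simp: w_def Q_def Pi_iff)
  have w_sum: "(\<Sum>k<m. w k l) = 1" for l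
  proof -
    have "(\<Sum>k<m. w k l) = (\<sigma> l + max 0 (1 - \<sigma> l)) / max 1 (\<sigma> l)"
      using m by (simp add: w_def sum_divide_distrib[symmetric] sum.distrib \<sigma>_def)
    then show ?thesis
      by (simp add: max_def)
  qed
  have b_in: "b l \<in> topspace P" if "l \<in> Q" for l
  proof -
    have "(\<Sum>k<m. w k l *\<^sub>R s k j) \<in> K j" if j: "j \<in> J" for j
      using K[OF j] w_nonneg[OF \<open>l \<in> Q\<close>] w_sum s j by (intro convex_sum) (auto simp: PiE_iff)
    then show ?thesis
      by (simp add: b_def top)
  qed
  have w_cont: "continuous_map (top_of_set Q) euclideanreal (w k)" for k
  proof -
    have "continuous_on Q (\<lambda>l. l i)" for i
      by (rule continuous_on_product_then_coordinatewise) (rule continuous_on_id)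
    then have "continuous_on Q (w k)"
      unfolding w_def \<sigma>_def using m by (intro continuous_intros) auto
    then show ?thesis
      by simp
  qed
  have b_cont: "continuous_map (top_of_set Q) P b"
    unfolding P_def continuous_map_componentwise
  proof (intro conjI ballI)
    show "b ` topspace (top_of_set Q) \<subseteq> extensional J"
      by (auto simp: b_def)
  next
    fix j assume j: "j \<in> J"
    have "s k j \<in> topspace (E j)" if "k < m" for k
      using s[OF that] K[OF j] j by blast
    then have "continuous_map (top_of_set Q) (E j) (\<lambda>l. \<Sum>k<m. w k l *\<^sub>R s k j)"
      by (intro real_tvs_continuous_map_sum[OF E[OF j]]
          real_tvs_continuous_map_scaleR[OF E[OF j]] w_cont) auto
    then have "continuous_map (top_of_set Q) (E j) (\<lambda>l. b l j)"
      using j by (simp add: b_def)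
    then show "continuous_map (top_of_set Q) (subtopology (E j) (K j)) (\<lambda>l. b l j)"
      using b_in j by (intro continuous_map_into_subtopology) (auto simp: top)
  qed
  have h_le: "\<psi> k x \<le> 1" if "k < m" "x \<in> topspace P" for k x
    using member_le_sum[of k "{..<m}" "\<lambda>k. \<psi> k x"] nonneg sum_1[of x] that by (auto simp: top)
  obtain l where l: "l \<in> Q" "h l = l"
  proof (rule Hilbert_cube_fixed_point[of h])
    have "continuous_on Q (\<lambda>l. h l k)" for k
      using continuous_map_compose[OF b_cont, of euclideanreal "\<psi> k"] cont[of k]
      by (cases "k < m") (simp_all add: h_def P_def o_def)
    then show "continuous_on (UNIV \<rightarrow> {0..1}) h"
      unfolding Q_def[symmetric] by (rule continuous_on_coordinatewise_then_product)
    show "h l \<in> UNIV \<rightarrow> {0..1}" if "l \<in> UNIV \<rightarrow> {0..1}" for l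
      using b_in[of l] that nonneg h_le by (auto simp: h_def top Q_def)
  qed (auto simp: Q_def)
  have l_eq: "l k = \<psi> k (b l)" if "k < m" for k
    using l(2) that by (metis h_def)
  then have "\<sigma> l = 1"
    using sum_1[of "b l"] b_in[OF l(1)] by (simp add: \<sigma>_def top)
  then have "w k l = l k" for k
    by (simp add: w_def)
  then have "w k l = \<psi> k (b l)" if "k < m" for k
    using l_eq[OF that] by (rule trans)
  moreover have "b l j = (\<Sum>k<m. w k l *\<^sub>R s k j)" if "j \<in> J" for j
    using that by (simp add: b_def)
  ultimately have "b l j = (\<Sum>k<m. \<psi> k (b l) *\<^sub>R s k j)" if "j \<in> J" for j
    using that by simp
  then show ?thesis
    using b_in[OF l(1)] unfolding top by blast
qed

text \<open>
  The sets \<open>D s\<close> of points \<open>x\<close> with \<open>s j \<in> T j x\<close> for all \<open>j\<close> are open, because \<open>J\<close> is finite, and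
  cover the product, because the values are nonempty.  Take a partition of unity \<open>\<psi>\<close> subordinate
  to them and a fixed point \<open>x\<close> of \<open>x \<mapsto> (\<Sum>k<m. \<psi> k x *\<^sub>R s k)\<close>.  Every \<open>s k\<close> with positive weight at
  \<open>x\<close> has its components in the convex sets \<open>T j x\<close>, hence so does their average \<open>x\<close>.
\<close>

theorem Browder_fixed_point_product:
  fixes E :: "'i \<Rightarrow> 'e::real_vector topology"
  assumes J: "finite J"
    and E: "\<And>j. j \<in> J \<Longrightarrow> real_tvs (E j) \<and> Hausdorff_space (E j)"
    and K: "\<And>j. j \<in> J \<Longrightarrow> K j \<noteq> {} \<and> convex (K j) \<and> compactin (E j) (K j)"
    and T: "\<And>j x. j \<in> J \<Longrightarrow> x \<in> (\<Pi>\<^sub>E j\<in>J. K j) \<Longrightarrow> T j x \<noteq> {} \<and> T j x \<subseteq> K j \<and> convex (T j x)"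
    and low: "\<And>j. j \<in> J \<Longrightarrow> open_lower_sections
      (product_topology (\<lambda>j. subtopology (E j) (K j)) J) (subtopology (E j) (K j)) (T j)"
  shows "\<exists>x \<in> (\<Pi>\<^sub>E j\<in>J. K j). \<forall>j \<in> J. x j \<in> T j x"
proof -
  define P where "P = product_topology (\<lambda>j. subtopology (E j) (K j)) J"
  have E_tvs: "real_tvs (E j)" if "j \<in> J" for j
    using E[OF that] by simp
  have K_convex: "K j \<subseteq> topspace (E j) \<and> convex (K j)" if "j \<in> J" for j
    using K[OF that] compactin_subset_topspace by blast
  then have top: "topspace P = (\<Pi>\<^sub>E j\<in>J. K j)"
    unfolding P_def topspace_product_topology by (intro PiE_cong) auto
  have comp: "compact_space P"
    unfolding P_def using K by (auto simp: compact_space_product_topology compact_space_subtopology)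
  have haus: "Hausdorff_space P"
    unfolding P_def using E by (auto simp: Hausdorff_space_product_topology Hausdorff_space_subtopology)
  define D where "D s = (\<Inter>j\<in>J. {x \<in> topspace P. s j \<in> T j x}) \<inter> topspace P" for s
  obtain m :: nat and s \<psi> where s: "\<And>k. k < m \<Longrightarrow> s k \<in> (\<Pi>\<^sub>E j\<in>J. K j)"
    and cont: "\<And>k. k < m \<Longrightarrow> continuous_map P euclideanreal (\<psi> k)"
    and nonneg: "\<And>k y. k < m \<Longrightarrow> y \<in> topspace P \<Longrightarrow> 0 \<le> \<psi> k y"
    and sum_1: "\<And>y. y \<in> topspace P \<Longrightarrow> (\<Sum>k<m. \<psi> k y) = 1"
    and supp: "\<And>k y. k < m \<Longrightarrow> y \<in> topspace P \<Longrightarrow> 0 < \<psi> k y \<Longrightarrow> y \<in> D (s k)"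
  proof (rule finite_partition_of_unity[OF comp haus, of "\<Pi>\<^sub>E j\<in>J. K j" D])
    show "openin P (D s)" if s: "s \<in> (\<Pi>\<^sub>E j\<in>J. K j)" for s
    proof -
      have "openin P {x \<in> topspace P. s j \<in> T j x}" if j: "j \<in> J" for j
        using low[OF j] s K_convex[OF j] j unfolding open_lower_sections_def P_def by auto
      then show ?thesis
        unfolding D_def by (intro openin_INT J)
    qed
    show "topspace P \<subseteq> (\<Union>s\<in>(\<Pi>\<^sub>E j\<in>J. K j). D s)"
    proof
      fix x assume x: "x \<in> topspace P"
      define s where "s = (\<lambda>j\<in>J. SOME y. y \<in> T j x)"
      have "s j \<in> T j x" if "j \<in> J" for j
        using T[OF that, of x] x that by (simp add: s_def top some_in_eq)
      moreover from this have "s \<in> (\<Pi>\<^sub>E j\<in>J. K j)"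
        using T[of _ x] x by (auto simp: top s_def)
      ultimately show "x \<in> (\<Union>s\<in>(\<Pi>\<^sub>E j\<in>J. K j). D s)"
        using x by (auto simp: D_def)
    qed
  qed auto
  have "(\<Pi>\<^sub>E j\<in>J. K j) \<noteq> {}"
    using K by (simp add: PiE_eq_empty_iff)
  then have m: "0 < m"
    using sum_1 by (cases m) (auto simp: top)
  have "\<exists>x \<in> (\<Pi>\<^sub>E j\<in>J. K j). \<forall>j \<in> J. x j = (\<Sum>k<m. \<psi> k x *\<^sub>R s k j)"
    by (rule fixed_point_of_finite_barycentric_map[OF E_tvs K_convex s m cont[unfolded P_def]
          nonneg[unfolded top] sum_1[unfolded top]])
  then obtain x where x: "x \<in> (\<Pi>\<^sub>E j\<in>J. K j)"
    and x_eq: "\<forall>j \<in> J. x j = (\<Sum>k<m. \<psi> k x *\<^sub>R s k j)"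
    by (elim bexE)
  have "x j \<in> T j x" if j: "j \<in> J" for j
  proof -
    define I where "I = {k \<in> {..<m}. 0 < \<psi> k x}"
    have I: "finite {..<m}" "I \<subseteq> {..<m}" "finite I"
      by (auto simp: I_def)
    have zero: "\<psi> k x = 0" if "k \<in> {..<m} - I" for k
      using nonneg[of k x] x that by (fastforce simp: I_def top)
    have "(\<Sum>k\<in>I. \<psi> k x *\<^sub>R s k j) \<in> T j x"
    proof (rule convex_sum)
      have "(\<Sum>k\<in>I. \<psi> k x) = (\<Sum>k<m. \<psi> k x)"
        using zero by (intro sum.mono_neutral_left I ballI)
      then show "(\<Sum>k\<in>I. \<psi> k x) = 1"
        using sum_1 x by (simp add: top)
      show "convex (T j x)"
        using T[OF j x] by blast
      show "0 \<le> \<psi> k x" if "k \<in> I" for k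
        using that by (simp add: I_def)
      show "s k j \<in> T j x" if "k \<in> I" for k
        using supp[of k x] that x j by (auto simp: D_def I_def top)
    qed (fact I)
    also have "(\<Sum>k\<in>I. \<psi> k x *\<^sub>R s k j) = (\<Sum>k<m. \<psi> k x *\<^sub>R s k j)"
      using zero by (intro sum.mono_neutral_left I ballI) simp
    finally show ?thesis
      using bspec[OF x_eq j] by simp
  qed
  then show ?thesis
    using x by blast
qed

section \<open>Inclusions between semicontinuous correspondences\<close>

lemma upper_semicontinuousE:
  assumes "upper_semicontinuous U V T" "u \<in> topspace U" "openin V W" "T u \<subseteq> W"
  obtains U' where "openin U U'" "u \<in> U'" "\<forall>u' \<in> U'. T u' \<subseteq> W"
  using assms(1)[unfolded upper_semicontinuous_def, rule_format, OF assms(2) conjI[OF assms(3,4)]]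
  by (elim exE conjE) (rule that; simp)

lemma lower_semicontinuousE:
  assumes "lower_semicontinuous U V T" "u \<in> topspace U" "openin V W" "T u \<inter> W \<noteq> {}"
  obtains U' where "openin U U'" "u \<in> U'" "\<forall>u' \<in> U'. T u' \<inter> W \<noteq> {}"
  using assms(1)[unfolded lower_semicontinuous_def, rule_format, OF assms(2) conjI[OF assms(3,4)]]
  by (elim exE conjE) (rule that; simp)

lemma upper_semicontinuous_compose:
  assumes "upper_semicontinuous U Y C" "continuous_map Z U g"
  shows "upper_semicontinuous Z Y (\<lambda>z. C (g z))"
  unfolding upper_semicontinuous_def
proof (intro ballI allI impI, elim conjE)
  fix z W
  assume z: "z \<in> topspace Z" and W: "openin Y W" "C (g z) \<subseteq> W"
  have "g z \<in> topspace U"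
    using continuous_map_funspace[OF assms(2)] z by blast
  then obtain U' where U': "openin U U'" "g z \<in> U'" "\<forall>u \<in> U'. C u \<subseteq> W"
    using upper_semicontinuousE[OF assms(1) _ W] by metis
  have "openin Z {z \<in> topspace Z. g z \<in> U'}"
    using assms(2) U'(1) by (rule openin_continuous_map_preimage)
  then show "\<exists>Z'. openin Z Z' \<and> z \<in> Z' \<and> (\<forall>z' \<in> Z'. C (g z') \<subseteq> W)"
    using U' z by blast
qed

lemma lower_semicontinuous_compose:
  assumes "lower_semicontinuous U Y C" "continuous_map Z U g"
  shows "lower_semicontinuous Z Y (\<lambda>z. C (g z))"
  unfolding lower_semicontinuous_def
proof (intro ballI allI impI, elim conjE)
  fix z W
  assume z: "z \<in> topspace Z" and W: "openin Y W" "C (g z) \<inter> W \<noteq> {}"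
  have "g z \<in> topspace U"
    using continuous_map_funspace[OF assms(2)] z by blast
  then obtain U' where U': "openin U U'" "g z \<in> U'" "\<forall>u \<in> U'. C u \<inter> W \<noteq> {}"
    using lower_semicontinuousE[OF assms(1) _ W] by metis
  have "openin Z {z \<in> topspace Z. g z \<in> U'}"
    using assms(2) U'(1) by (rule openin_continuous_map_preimage)
  then show "\<exists>Z'. openin Z Z' \<and> z \<in> Z' \<and> (\<forall>z' \<in> Z'. C (g z') \<inter> W \<noteq> {})"
    using U' z by blast
qed

text \<open>
  If \<open>y \<in> G z\<close> lies outside \<open>C z\<close>, separate \<open>y\<close> from \<open>C z\<close> by open sets.  Near \<open>z\<close>, lower
  semicontinuity keeps \<open>G\<close> meeting the first and upper semicontinuity keeps \<open>C\<close> inside the second,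
  so the inclusion fails in a whole neighbourhood of \<open>z\<close>.
\<close>

lemma closedin_correspondence_inclusion:
  assumes Y: "regular_space Y"
    and G: "lower_semicontinuous Z Y G"
    and C: "upper_semicontinuous Z Y C"
    and G_sub: "\<And>z. z \<in> topspace Z \<Longrightarrow> G z \<subseteq> topspace Y"
    and C_closed: "\<And>z. z \<in> topspace Z \<Longrightarrow> closedin Y (C z)"
  shows "closedin Z {z \<in> topspace Z. G z \<subseteq> C z}"
proof -
  have "\<exists>N. openin Z N \<and> z \<in> N \<and> N \<subseteq> {z \<in> topspace Z. \<not> G z \<subseteq> C z}"
    if z: "z \<in> topspace Z" "\<not> G z \<subseteq> C z" for z
  proof -
    obtain y where y: "y \<in> G z" "y \<in> topspace Y - C z"
      using z G_sub by blast
    then obtain V W where V: "openin Y V" "y \<in> V" and W: "openin Y W" "C z \<subseteq> W" and VW: "disjnt V W"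
      using Y[unfolded regular_space_def, rule_format, of "C z" y] C_closed[OF z(1)] by blast
    obtain N1 where N1: "openin Z N1" "z \<in> N1" "\<forall>z' \<in> N1. G z' \<inter> V \<noteq> {}"
      using lower_semicontinuousE[OF G z(1) V(1)] V(2) y(1) by blast
    obtain N2 where N2: "openin Z N2" "z \<in> N2" "\<forall>z' \<in> N2. C z' \<subseteq> W"
      using upper_semicontinuousE[OF C z(1) W] by metis
    have "openin Z (N1 \<inter> N2)"
      using N1 N2 by blast
    moreover have "N1 \<inter> N2 \<subseteq> {z \<in> topspace Z. \<not> G z \<subseteq> C z}"
      using N1(3) N2(3) VW openin_subset[OF N1(1)] unfolding disjnt_def by blast
    ultimately show ?thesis
      using N1 N2 by blast
  qed
  then have "openin Z {z \<in> topspace Z. \<not> G z \<subseteq> C z}"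
    by (intro openin_subopen[THEN iffD2]) blast
  moreover have "topspace Z - {z \<in> topspace Z. G z \<subseteq> C z} = {z \<in> topspace Z. \<not> G z \<subseteq> C z}"
    by blast
  ultimately show ?thesis
    by (auto simp: closedin_def)
qed

lemma subset_graph_closure:
  assumes "u \<in> topspace U" "A u \<subseteq> topspace V"
  shows "A u \<subseteq> graph_closure U V A u"
proof
  fix v assume v: "v \<in> A u"
  have "(u, v) \<in> topspace (prod_topology U V) \<inter> (SIGMA w : topspace U. A w)"
    using assms v by auto
  then have "(u, v) \<in> prod_topology U V closure_of (SIGMA w : topspace U. A w)"
    using closure_of_subset_Int by fast
  then show "v \<in> graph_closure U V A u"
    using assms v by (auto simp: graph_closure_def)
qed

text \<open>
  The complement consists of the pairs \<open>(p, q)\<close> for which some \<open>u\<close> in the closed graph over \<open>p\<close>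
  satisfies \<open>g p q u \<subseteq> C p\<close>.  It is the projection of a closed set along the compact factor \<open>V\<close>,
  hence closed.  This is where the closure of the graph of \<open>A\<close> matters: over \<open>A\<close> itself the
  projected set need not be closed.
\<close>

lemma openin_uniform_noninclusion:
  assumes V: "compact_space V" and Y: "regular_space Y"
    and g: "lower_semicontinuous (prod_topology U (prod_topology W V)) Y (\<lambda>(p, q, u). g p q u)"
    and g_sub: "\<And>p q u. p \<in> topspace U \<Longrightarrow> q \<in> topspace W \<Longrightarrow> u \<in> topspace V \<Longrightarrow>
      g p q u \<subseteq> topspace Y"
    and C: "upper_semicontinuous U Y C"
    and C_closed: "\<And>p. p \<in> topspace U \<Longrightarrow> closedin Y (C p)"
  shows "openin (prod_topology U W)
    {(p, q). p \<in> topspace U \<and> q \<in> topspace W \<and> (\<forall>u \<in> graph_closure U V A p. \<not> g p q u \<subseteq> C p)}"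
proof -
  define Z where "Z = prod_topology (prod_topology U W) V"
  define Cl where "Cl = prod_topology U V closure_of (SIGMA w : topspace U. A w)"
  note components = continuous_map_fst_of[unfolded o_def] continuous_map_snd_of[unfolded o_def]
  have p: "continuous_map Z U (\<lambda>z. fst (fst z))" and q: "continuous_map Z W (\<lambda>z. snd (fst z))"
    and u: "continuous_map Z V snd"
    unfolding Z_def by (rule components[OF continuous_map_fst] continuous_map_snd)+
  have "closedin Z {z \<in> topspace Z. g (fst (fst z)) (snd (fst z)) (snd z) \<subseteq> C (fst (fst z))}"
  proof (rule closedin_correspondence_inclusion[OF Y])
    show "lower_semicontinuous Z Y (\<lambda>z. g (fst (fst z)) (snd (fst z)) (snd z))"
      using lower_semicontinuous_compose[OF g, of Z "\<lambda>z. (fst (fst z), snd (fst z), snd z)"]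
        continuous_map_pairedI[OF p continuous_map_pairedI[OF q u]] by simp
    show "upper_semicontinuous Z Y (\<lambda>z. C (fst (fst z)))"
      using C p by (rule upper_semicontinuous_compose)
    show "g (fst (fst z)) (snd (fst z)) (snd z) \<subseteq> topspace Y" if "z \<in> topspace Z" for z
      using that by (intro g_sub) (auto simp: Z_def)
  qed (use C_closed in \<open>auto simp: Z_def\<close>)
  moreover have "closedin Z {z \<in> topspace Z. (fst (fst z), snd z) \<in> Cl}"
    using continuous_map_pairedI[OF p u]
    by (rule closedin_continuous_map_preimage) (simp add: Cl_def)
  ultimately have "closedin (prod_topology U W) (fst `
      ({z \<in> topspace Z. g (fst (fst z)) (snd (fst z)) (snd z) \<subseteq> C (fst (fst z))} \<inter>
       {z \<in> topspace Z. (fst (fst z), snd z) \<in> Cl}))" (is "closedin _ (fst ` ?B)")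
    using Abstract_Topological_Spaces.closed_map_fst[OF V, of "prod_topology U W"]
    by (simp add: closed_map_def Z_def closedin_Int)
  moreover have "fst ` ?B =
    {(p, q). p \<in> topspace U \<and> q \<in> topspace W \<and> (\<exists>u \<in> graph_closure U V A p. g p q u \<subseteq> C p)}"
    (is "_ = ?R")
  proof
    show "fst ` ?B \<subseteq> ?R"
      by (auto simp: Z_def graph_closure_def Cl_def)
    show "?R \<subseteq> fst ` ?B"
    proof clarify
      fix p q u
      assume "p \<in> topspace U" "q \<in> topspace W" "u \<in> graph_closure U V A p" "g p q u \<subseteq> C p"
      then show "(p, q) \<in> fst ` ?B"
        by (intro image_eqI[of _ _ "((p, q), u)"]) (auto simp: Z_def graph_closure_def Cl_def)
    qed
  qed
  ultimately have "closedin (prod_topology U W) ?R"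
    by (simp only:)
  then have "openin (prod_topology U W) (topspace (prod_topology U W) - ?R)"
    by (intro openin_diff openin_topspace)
  also have "topspace (prod_topology U W) - ?R =
    {(p, q). p \<in> topspace U \<and> q \<in> topspace W \<and> (\<forall>u \<in> graph_closure U V A p. \<not> g p q u \<subseteq> C p)}"
    by auto
  finally show ?thesis .
qed

text \<open>
  If \<open>G\<close> of the convex combination were inside \<open>D\<close>, quasi-convexity would put \<open>G k\<^sub>1\<close> or \<open>G k\<^sub>2\<close> inside
  \<open>D + D\<close>, which is contained in \<open>D\<close> for a convex cone.
\<close>

lemma quasi_convex_corr_noninclusion:
  assumes G: "quasi_convex_corr K D G" and D: "convex D" "cone D"
    and k: "k\<^sub>1 \<in> K" "k\<^sub>2 \<in> K" and "\<not> G k\<^sub>1 \<subseteq> D" "\<not> G k\<^sub>2 \<subseteq> D"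
    and st: "0 \<le> s" "0 \<le> t" "s + t = 1"
  shows "\<not> G (s *\<^sub>R k\<^sub>1 + t *\<^sub>R k\<^sub>2) \<subseteq> D"
proof
  assume sub: "G (s *\<^sub>R k\<^sub>1 + t *\<^sub>R k\<^sub>2) \<subseteq> D"
  have "1 - s = t" "s \<in> {0..1}"
    using st by auto
  then have "G k\<^sub>1 \<subseteq> G (s *\<^sub>R k\<^sub>1 + t *\<^sub>R k\<^sub>2) + D \<or> G k\<^sub>2 \<subseteq> G (s *\<^sub>R k\<^sub>1 + t *\<^sub>R k\<^sub>2) + D"
    using bspec[OF bspec[OF bspec[OF G[unfolded quasi_convex_corr_def] k(1)] k(2)], of s] by simp
  moreover have "G (s *\<^sub>R k\<^sub>1 + t *\<^sub>R k\<^sub>2) + D \<subseteq> D"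
    using sub D convex_cone[of D] by (auto elim!: set_plus_elim)
  ultimately show False
    using assms(6,7) by blast
qed

section \<open>Existence of an equilibrium pair\<close>

theorem theorem12:
  fixes n :: nat
    and E :: "nat \<Rightarrow> 'e::real_vector topology"
    and Y :: "nat \<Rightarrow> 'y::real_vector topology"
    and X :: "nat \<Rightarrow> 'e set"
    and A F :: "nat \<Rightarrow> (nat \<Rightarrow> 'e) \<Rightarrow> 'e set"
    and C :: "nat \<Rightarrow> (nat \<Rightarrow> 'e) \<Rightarrow> 'y set"
    and f :: "nat \<Rightarrow> (nat \<Rightarrow> 'e) \<Rightarrow> (nat \<Rightarrow> 'e) \<Rightarrow> 'e \<Rightarrow> 'y set"
  assumes E: "\<And>i. i \<in> {1..n} \<Longrightarrow> locally_convex_tvs (E i) \<and> Hausdorff_space (E i)"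
    and Y: "\<And>i. i \<in> {1..n} \<Longrightarrow> real_tvs (Y i)"
    and X: "\<And>i. i \<in> {1..n} \<Longrightarrow> X i \<noteq> {} \<and> convex (X i) \<and> compactin (E i) (X i)"
    and A: "\<And>i. i \<in> {1..n} \<Longrightarrow>
      nonempty_correspondence (others_top n E X i) (subtopology (E i) (X i)) (A i)"
    and F: "\<And>i. i \<in> {1..n} \<Longrightarrow>
      nonempty_correspondence (others_top n E X i) (subtopology (E i) (X i)) (F i)"
    and C: "\<And>i. i \<in> {1..n} \<Longrightarrow> nonempty_correspondence (others_top n E X i) (Y i) (C i)"
    and C_cone: "\<And>i p. i \<in> {1..n} \<Longrightarrow> p \<in> topspace (others_top n E X i) \<Longrightarrow>
      proper_closed_convex_cone (Y i) (C i p) \<and> Y i interior_of C i p \<noteq> {}"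
    and f: "\<And>i x y u. i \<in> {1..n} \<Longrightarrow> x \<in> (\<Pi>\<^sub>E j\<in>{1..n}. X j) \<Longrightarrow> y \<in> (\<Pi>\<^sub>E j\<in>{1..n}. X j) \<Longrightarrow>
      u \<in> X i \<Longrightarrow> f i x y u \<noteq> {} \<and> f i x y u \<subseteq> topspace (Y i)"
    and a_convex: "\<And>i p. i \<in> {1..n} \<Longrightarrow> p \<in> topspace (others_top n E X i) \<Longrightarrow>
      convex (A i p) \<and> convex (F i p)"
    and a_open: "\<And>i. i \<in> {1..n} \<Longrightarrow>
      open_lower_sections (others_top n E X i) (subtopology (E i) (X i)) (A i) \<and>
      open_lower_sections (others_top n E X i) (subtopology (E i) (X i)) (F i)"
    and b: "\<And>i a b. i \<in> {1..n} \<Longrightarrow> a \<in> X i \<Longrightarrow> b \<in> X i \<Longrightarrow>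
      lower_semicontinuous
        (prod_topology (others_top n E X i)
          (prod_topology (others_top n E X i) (subtopology (E i) (X i))))
        (Y i)
        (\<lambda>(p, q, u). f i (p(i := a)) (q(i := b)) u)"
    and c: "\<And>i. i \<in> {1..n} \<Longrightarrow> upper_semicontinuous (others_top n E X i) (Y i) (C i)"
    and d: "\<And>i p q. i \<in> {1..n} \<Longrightarrow>
      p \<in> topspace (others_top n E X i) \<Longrightarrow> q \<in> topspace (others_top n E X i) \<Longrightarrow>
      \<exists>a \<in> A i p. \<exists>b \<in> F i q.
        \<forall>u \<in> graph_closure (others_top n E X i) (subtopology (E i) (X i)) (A i) p.
          \<not> f i (p(i := a)) (q(i := b)) u \<subseteq> C i p"
    and e: "\<And>i p q u. i \<in> {1..n} \<Longrightarrow>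
      p \<in> topspace (others_top n E X i) \<Longrightarrow> q \<in> topspace (others_top n E X i) \<Longrightarrow> u \<in> X i \<Longrightarrow>
      quasi_convex_corr (X i \<times> X i) (C i p) (\<lambda>(a, b). f i (p(i := a)) (q(i := b)) u)"
  shows "\<exists>x \<in> (\<Pi>\<^sub>E j\<in>{1..n}. X j). \<exists>y \<in> (\<Pi>\<^sub>E j\<in>{1..n}. X j). \<forall>i \<in> {1..n}.
    x i \<in> A i (others n i x) \<and>
    y i \<in> F i (others n i y) \<and>
    (\<forall>u \<in> A i (others n i x). \<not> f i x y u \<subseteq> Y i interior_of C i (others n i x))"
proof -
  define J where "J = {1..n}"
  define V where "V = (\<lambda>i. subtopology (E i) (X i))"
  define U where "U i = others_top n E X i" for i
  have X_top: "X i \<subseteq> topspace (E i)" if "i \<in> J" for i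
    using X[of i] that compactin_subset_topspace by (auto simp: J_def)
  have V_top: "topspace (V i) = X i" if "i \<in> J" for i
    using X_top[OF that] by (auto simp: V_def)
  have U_def': "U i = product_topology V (J - {i})" for i
    by (simp add: U_def others_top_def V_def J_def)
  have U_top: "topspace (U i) = (\<Pi>\<^sub>E j\<in>J - {i}. X j)" for i
    unfolding U_def' topspace_product_topology by (rule PiE_cong) (simp add: V_top)
  have upd: "p(i := a) \<in> (\<Pi>\<^sub>E j\<in>J. X j)" if "i \<in> J" "p \<in> topspace (U i)" "a \<in> X i" for i p a
    using PiE_fun_upd[of a X i p "J - {i}"] that by (simp add: U_top insert_absorb)

  \<comment> \<open>The set \<open>R i p q\<close> of admissible choices of player \<open>i\<close> asks for noninclusion in the closed cone and
      over the closed graph, which is stronger than the goal but gives open lower sections.\<close>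
  define R where "R i p q = {(a, b). a \<in> A i p \<and> b \<in> F i q \<and>
      (\<forall>u \<in> graph_closure (U i) (V i) (A i) p. \<not> f i (p(i := a)) (q(i := b)) u \<subseteq> C i p)}"
    for i p q
  have R_sub: "R i p q \<subseteq> X i \<times> X i"
    if "i \<in> J" "p \<in> topspace (U i)" "q \<in> topspace (U i)" for i p q
    using A[of i] F[of i] that V_top[of i]
    by (auto simp: R_def nonempty_correspondence_def J_def U_def V_def)
  have R_nonempty: "R i p q \<noteq> {}"
    if "i \<in> J" "p \<in> topspace (U i)" "q \<in> topspace (U i)" for i p q
    using d[of i p q] that unfolding R_def J_def U_def V_def by blast
  have R_convex: "convex (R i p q)"
    if i: "i \<in> J" and p: "p \<in> topspace (U i)" and q: "q \<in> topspace (U i)" for i p q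
    unfolding convex_def
  proof (intro ballI allI impI)
    fix k\<^sub>1 k\<^sub>2 and s t :: real
    assume k: "k\<^sub>1 \<in> R i p q" "k\<^sub>2 \<in> R i p q" and st: "0 \<le> s" "0 \<le> t" "s + t = 1"
    obtain a\<^sub>1 b\<^sub>1 a\<^sub>2 b\<^sub>2 where eq: "k\<^sub>1 = (a\<^sub>1, b\<^sub>1)" "k\<^sub>2 = (a\<^sub>2, b\<^sub>2)"
      by (metis surj_pair)
    have "s *\<^sub>R a\<^sub>1 + t *\<^sub>R a\<^sub>2 \<in> A i p" "s *\<^sub>R b\<^sub>1 + t *\<^sub>R b\<^sub>2 \<in> F i q"
      using a_convex[of i p] a_convex[of i q] i p q k st
      by (auto simp: R_def eq J_def U_def intro!: convexD)
    moreover have "\<not> f i (p(i := s *\<^sub>R a\<^sub>1 + t *\<^sub>R a\<^sub>2)) (q(i := s *\<^sub>R b\<^sub>1 + t *\<^sub>R b\<^sub>2)) u \<subseteq> C i p"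
      if u: "u \<in> graph_closure (U i) (V i) (A i) p" for u
    proof -
      have "u \<in> X i"
        using u V_top[OF i] by (simp add: graph_closure_def)
      then have "quasi_convex_corr (X i \<times> X i) (C i p) (\<lambda>(a, b). f i (p(i := a)) (q(i := b)) u)"
        using e i p q by (simp add: J_def U_def)
      moreover have "convex (C i p)" "cone (C i p)"
        using C_cone[of i p] i p by (auto simp: proper_closed_convex_cone_def J_def U_def)
      moreover have "k\<^sub>1 \<in> X i \<times> X i" "k\<^sub>2 \<in> X i \<times> X i"
        using k R_sub[OF i p q] by blast+
      ultimately have "\<not> (\<lambda>(a, b). f i (p(i := a)) (q(i := b)) u) (s *\<^sub>R k\<^sub>1 + t *\<^sub>R k\<^sub>2) \<subseteq> C i p"
        by (rule quasi_convex_corr_noninclusion) (use k u st in \<open>auto simp: R_def eq\<close>)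
      then show ?thesis
        by (simp add: eq)
    qed
    ultimately show "s *\<^sub>R k\<^sub>1 + t *\<^sub>R k\<^sub>2 \<in> R i p q"
      by (simp add: R_def eq)
  qed
  have R_open: "openin (prod_topology (U i) (U i))
      {(p, q). p \<in> topspace (U i) \<and> q \<in> topspace (U i) \<and> (a, b) \<in> R i p q}"
    if i: "i \<in> J" and a: "a \<in> X i" and b': "b \<in> X i" for i a b
  proof -
    have i': "i \<in> {1..n}"
      using i by (simp add: J_def)
    have "openin (U i) {p \<in> topspace (U i). a \<in> A i p}" "openin (U i) {q \<in> topspace (U i). b \<in> F i q}"
      using a_open[OF i'] a b' V_top[OF i] by (auto simp: open_lower_sections_def U_def V_def)
    then have "openin (prod_topology (U i) (U i))
        ({p \<in> topspace (U i). a \<in> A i p} \<times> {q \<in> topspace (U i). b \<in> F i q})"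
      by (simp add: openin_prod_Times_iff)
    moreover have "openin (prod_topology (U i) (U i))
      {(p, q). p \<in> topspace (U i) \<and> q \<in> topspace (U i) \<and>
        (\<forall>u \<in> graph_closure (U i) (V i) (A i) p. \<not> f i (p(i := a)) (q(i := b)) u \<subseteq> C i p)}"
    proof (rule openin_uniform_noninclusion)
      show "compact_space (V i)"
        using X[OF i'] by (simp add: V_def compact_space_subtopology)
      show "regular_space (Y i)"
        using Y[OF i'] by (rule real_tvs_regular_space)
      show "lower_semicontinuous (prod_topology (U i) (prod_topology (U i) (V i))) (Y i)
          (\<lambda>(p, q, u). f i (p(i := a)) (q(i := b)) u)"
        using b[OF i' a b'] by (simp add: U_def V_def)
      show "f i (p(i := a)) (q(i := b)) u \<subseteq> topspace (Y i)"
        if "p \<in> topspace (U i)" "q \<in> topspace (U i)" "u \<in> topspace (V i)" for p q u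
        using f[of i "p(i := a)" "q(i := b)" u] upd[OF i] that a b' V_top[OF i] i by (simp add: J_def)
      show "upper_semicontinuous (U i) (Y i) (C i)"
        using c[OF i'] by (simp add: U_def)
      show "closedin (Y i) (C i p)" if "p \<in> topspace (U i)" for p
        using C_cone[OF i'] that by (simp add: proper_closed_convex_cone_def U_def)
    qed
    ultimately have "openin (prod_topology (U i) (U i))
      (({p \<in> topspace (U i). a \<in> A i p} \<times> {q \<in> topspace (U i). b \<in> F i q}) \<inter>
      {(p, q). p \<in> topspace (U i) \<and> q \<in> topspace (U i) \<and>
        (\<forall>u \<in> graph_closure (U i) (V i) (A i) p. \<not> f i (p(i := a)) (q(i := b)) u \<subseteq> C i p)})"
      by (rule openin_Int)
    also have "({p \<in> topspace (U i). a \<in> A i p} \<times> {q \<in> topspace (U i). b \<in> F i q}) \<inter>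
      {(p, q). p \<in> topspace (U i) \<and> q \<in> topspace (U i) \<and>
        (\<forall>u \<in> graph_closure (U i) (V i) (A i) p. \<not> f i (p(i := a)) (q(i := b)) u \<subseteq> C i p)} =
      {(p, q). p \<in> topspace (U i) \<and> q \<in> topspace (U i) \<and> (a, b) \<in> R i p q}"
      unfolding R_def by blast
    finally show ?thesis .
  qed

  \<comment> \<open>Pairing the two strategies of each player makes a fixed point of the single family \<open>R\<close> encode
      both profiles.  \<open>\<pi> fst i z\<close> and \<open>\<pi> snd i z\<close> are the profiles of the other players.\<close>
  define EE where "EE i = prod_topology (E i) (E i)" for i
  define K where "K i = X i \<times> X i" for i
  have VV: "subtopology (EE i) (K i) = prod_topology (V i) (V i)" for i
    by (simp add: EE_def K_def V_def subtopology_Times)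
  define P where "P = product_topology (\<lambda>i. subtopology (EE i) (K i)) J"
  have P_top: "topspace P = (\<Pi>\<^sub>E j\<in>J. K j)"
    unfolding P_def VV topspace_product_topology
    by (rule PiE_cong) (simp add: V_top K_def)
  define \<pi> where "\<pi> g i z = others n i (\<lambda>j. g (z j))"
    for g :: "'e \<times> 'e \<Rightarrow> 'e" and i and z :: "nat \<Rightarrow> 'e \<times> 'e"
  have \<pi>_cont: "continuous_map P (U i) (\<pi> g i)"
    if g: "\<And>j. continuous_map (prod_topology (V j) (V j)) (V j) g" for g i
    unfolding U_def' continuous_map_componentwise
  proof (intro conjI ballI)
    show "\<pi> g i ` topspace P \<subseteq> extensional (J - {i})"
      by (auto simp: \<pi>_def others_def J_def)
    fix k assume k: "k \<in> J - {i}"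
    have "continuous_map P (prod_topology (V k) (V k)) (\<lambda>z. z k)"
      unfolding P_def VV using k by (intro continuous_map_product_projection) simp
    from continuous_map_compose[OF this g]
    show "continuous_map P (V k) (\<lambda>z. \<pi> g i z k)"
      using k by (simp add: \<pi>_def others_def J_def o_def)
  qed
  note \<pi>_fst = \<pi>_cont[OF continuous_map_fst] and \<pi>_snd = \<pi>_cont[OF continuous_map_snd]
  have \<pi>_top: "\<pi> fst i z \<in> topspace (U i)" "\<pi> snd i z \<in> topspace (U i)"
    if "z \<in> (\<Pi>\<^sub>E j\<in>J. K j)" for i z
    using continuous_map_funspace[OF \<pi>_fst[of i]] continuous_map_funspace[OF \<pi>_snd[of i]] that
    unfolding P_top by blast+
  have "\<exists>z \<in> (\<Pi>\<^sub>E j\<in>J. K j). \<forall>i \<in> J. z i \<in> R i (\<pi> fst i z) (\<pi> snd i z)"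
  proof (rule Browder_fixed_point_product[where E = EE])
    show "finite J"
      by (simp add: J_def)
  next
    fix i assume i: "i \<in> J"
    then have i': "i \<in> {1..n}"
      by (simp add: J_def)
    show "real_tvs (EE i) \<and> Hausdorff_space (EE i)"
      using E[OF i']
      by (simp add: EE_def locally_convex_tvs_def real_tvs_prod_topology Hausdorff_space_prod_topology)
    show "K i \<noteq> {} \<and> convex (K i) \<and> compactin (EE i) (K i)"
      using X[OF i'] by (simp add: K_def EE_def convex_Times compactin_Times)
    show "R i (\<pi> fst i z) (\<pi> snd i z) \<noteq> {} \<and> R i (\<pi> fst i z) (\<pi> snd i z) \<subseteq> K i \<and>
        convex (R i (\<pi> fst i z) (\<pi> snd i z))" if "z \<in> (\<Pi>\<^sub>E j\<in>J. K j)" for z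
      using R_nonempty[OF i \<pi>_top[OF that]] R_sub[OF i \<pi>_top[OF that]]
        R_convex[OF i \<pi>_top[OF that]] by (simp add: K_def)
    show "open_lower_sections (product_topology (\<lambda>j. subtopology (EE j) (K j)) J)
        (subtopology (EE i) (K i)) (\<lambda>z. R i (\<pi> fst i z) (\<pi> snd i z))"
      unfolding open_lower_sections_def P_def[symmetric]
    proof
      fix v assume "v \<in> topspace (subtopology (EE i) (K i))"
      then obtain a b where v: "v = (a, b)" "a \<in> X i" "b \<in> X i"
        by (auto simp: K_def)
      have "openin P {z \<in> topspace P. (\<pi> fst i z, \<pi> snd i z) \<in>
        {(p, q). p \<in> topspace (U i) \<and> q \<in> topspace (U i) \<and> (a, b) \<in> R i p q}}"
        using continuous_map_pairedI[OF \<pi>_fst \<pi>_snd] R_open[OF i v(2,3)]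
        by (rule openin_continuous_map_preimage)
      also have "{z \<in> topspace P. (\<pi> fst i z, \<pi> snd i z) \<in>
        {(p, q). p \<in> topspace (U i) \<and> q \<in> topspace (U i) \<and> (a, b) \<in> R i p q}} =
        {z \<in> topspace P. v \<in> R i (\<pi> fst i z) (\<pi> snd i z)}"
        using \<pi>_top by (auto simp: P_top v(1))
      finally show "openin P {z \<in> topspace P. v \<in> R i (\<pi> fst i z) (\<pi> snd i z)}" .
    qed
  qed
  then obtain z where z: "z \<in> (\<Pi>\<^sub>E j\<in>J. K j)"
    and z_R: "\<forall>i \<in> J. z i \<in> R i (\<pi> fst i z) (\<pi> snd i z)"
    by (elim bexE)

  define x where "x = (\<lambda>j\<in>J. fst (z j))"
  define y where "y = (\<lambda>j\<in>J. snd (z j))"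
  have xy: "x \<in> (\<Pi>\<^sub>E j\<in>J. X j)" "y \<in> (\<Pi>\<^sub>E j\<in>J. X j)"
    using z by (auto simp: x_def y_def K_def PiE_iff mem_Times_iff)
  have \<pi>_eq: "\<pi> fst i z = others n i x" "\<pi> snd i z = others n i y" for i
    by (auto simp: \<pi>_def others_def x_def y_def J_def)
  have "x i \<in> A i (others n i x) \<and> y i \<in> F i (others n i y) \<and>
      (\<forall>u \<in> A i (others n i x). \<not> f i x y u \<subseteq> Y i interior_of C i (others n i x))"
    if i: "i \<in> J" for i
  proof -
    have others_upd: "(others n i w)(i := w i) = w" if "w \<in> (\<Pi>\<^sub>E j\<in>J. X j)" for w
      using that i by (auto simp: others_def J_def fun_eq_iff PiE_def extensional_def)
    have "(x i, y i) \<in> R i (others n i x) (others n i y)"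
      using bspec[OF z_R i] i by (simp add: \<pi>_eq x_def y_def)
    then have A_x: "x i \<in> A i (others n i x)" and F_y: "y i \<in> F i (others n i y)"
      and f_x: "\<forall>u \<in> graph_closure (U i) (V i) (A i) (others n i x). \<not> f i x y u \<subseteq> C i (others n i x)"
      by (simp_all add: R_def others_upd xy)
    have x_top: "others n i x \<in> topspace (U i)"
      using \<pi>_top(1)[OF z] by (simp add: \<pi>_eq)
    then have "A i (others n i x) \<subseteq> graph_closure (U i) (V i) (A i) (others n i x)"
      using A[of i] i by (intro subset_graph_closure) (auto simp: nonempty_correspondence_def J_def U_def V_def)
    moreover have "Y i interior_of C i (others n i x) \<subseteq> C i (others n i x)"
      by (rule interior_of_subset)
    ultimately show ?thesis
      using A_x F_y f_x by blast
  qed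
  then show ?thesis
    using xy unfolding J_def by blast
qed

end
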